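(* The relation algebra $56_{65}$ has a square representation.
   Context: A relation algebra is an algebra $\mathbf{A}=(A;\cup,\bar{\ },0,1,\mathrm{Id},\breve{\ },\circ)$ such that, with $x\cap y:=\overline{(\bar x\cup\bar y)}$, the structure $(A;\cup,\cap,\bar{\ },0,1)$ is a Boolean algebra, $\circ$ is associative, and for all $a,b,c\in A$: $(a\cup b)\circ c=(a\circ c)\cup(b\circ c)$; $a\circ\mathrm{Id}=a$; $\breve{\breve a}=a$; $(a\cup b)\breve{\ }=\breve a\cup\breve b$; $(a\circ b)\breve{\ }=\breve b\circ\breve a$; $\bar b\cup(\breve a\circ\overline{(a\circ b)})=\bar b$. Write $a\le b$ if $a\cap b=a$. An atom is a minimal element of $A\setminus\{0\}$ with respect to $\le$. In a finite relation algebra, $\circ$ and $\breve{\ }$ are determined by their values on atoms. $56_{65}$ is the finite relation algebra with exactly four atoms $\mathrm{Id},a,b,c$, all satisfying $\breve x=x$, where $\mathrm{Id}\circ x=x\circ\mathrm{Id}=x$, where for $x,y\in\{a,b,c\}$ we have $\mathrm{Id}\le x\circ y$ iff $x=y$, and where for $x,y,z\in\{a,b,c\}$ we have $z\le x\circ y$ iff $(x,y,z)$ is neither $(a,a,a)$, nor $(c,c,c)$, nor a permutation of $(c,b,b)$. A representation of $\mathbf{A}$ is a relational structure $\mathfrak{B}$ with domain $B$ and a binary relation $a^{\mathfrak{B}}\subseteq B^2$ for each $a\in A$ such that for all $a,b\in A$: $0^{\mathfrak{B}}=\varnothing$; $1^{\mathfrak{B}}=\bigcup_{a\in A}a^{\mathfrak{B}}$;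 $\mathrm{Id}^{\mathfrak{B}}=\{(u,u)\mid u\in B\}$; $(\bar a)^{\mathfrak{B}}=1^{\mathfrak{B}}\setminus a^{\mathfrak{B}}$; $(\breve a)^{\mathfrak{B}}=\{(u,v)\mid(v,u)\in a^{\mathfrak{B}}\}$; $(a\cup b)^{\mathfrak{B}}=a^{\mathfrak{B}}\cup b^{\mathfrak{B}}$; $(a\circ b)^{\mathfrak{B}}=a^{\mathfrak{B}}\circ b^{\mathfrak{B}}$ (the usual composition of binary relations), and such that distinct elements of $A$ denote distinct relations. It is square if $1^{\mathfrak{B}}=B^2$. *)

theory Defs
  imports Main
begin

locale relation_algebra =
  fixes ident :: "'a::boolean_algebra"
    and conv :: "'a \<Rightarrow> 'a"
    and rcomp :: "'a \<Rightarrow> 'a \<Rightarrow> 'a"  (infixl "\<odot>" 75)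
  assumes rcomp_assoc: "(x \<odot> y) \<odot> z = x \<odot> (y \<odot> z)"
    and rcomp_sup_left: "sup x y \<odot> z = sup (x \<odot> z) (y \<odot> z)"
    and rcomp_ident: "x \<odot> ident = x"
    and conv_conv: "conv (conv x) = x"
    and conv_sup: "conv (sup x y) = sup (conv x) (conv y)"
    and conv_rcomp: "conv (x \<odot> y) = conv y \<odot> conv x"
    and residual: "sup (- y) (conv x \<odot> (- (x \<odot> y))) = - y"

locale representation = relation_algebra ident conv rcomp
  for ident :: "'a::boolean_algebra" and conv :: "'a \<Rightarrow> 'a"
    and rcomp :: "'a \<Rightarrow> 'a \<Rightarrow> 'a" +
  fixes B :: "'b set"
    and R :: "'a \<Rightarrow> ('b \<times> 'b) set"
  assumes rel_on: "R x \<subseteq> B \<times> B"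
    and rep_bot: "R bot = {}"
    and rep_top: "R top = (\<Union>x. R x)"
    and rep_ident: "R ident = Id_on B"
    and rep_compl: "R (- x) = R top - R x"
    and rep_conv: "R (conv x) = {(u, v). (v, u) \<in> R x}"
    and rep_sup: "R (sup x y) = R x \<union> R y"
    and rep_rcomp: "R (rcomp x y) = R x O R y"
    and rep_inj: "inj R"

locale square_representation = representation +
  assumes square: "R top = B \<times> B"

datatype atom = AtId | AtA | AtB | AtC

text \<open>
  The algebra \<open>56\<^sub>6\<^sub>5\<close> lives on the Boolean algebra of all sets of atoms, an element being
  identified with the set of atoms below it.
\<close>

definition forbidden_56_65 :: "(atom \<times> atom \<times> atom) set" where
  "forbidden_56_65 =
    {(AtA, AtA, AtA), (AtC, AtC, AtC), (AtC, AtB, AtB), (AtB, AtC, AtB), (AtB, AtB, AtC)}"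

definition atom_comp_56_65 :: "atom \<Rightarrow> atom \<Rightarrow> atom set" where
  "atom_comp_56_65 x y =
    (if x = AtId then {y}
     else if y = AtId then {x}
     else {z. if z = AtId then x = y else (x, y, z) \<notin> forbidden_56_65})"

definition ident_56_65 :: "atom set" where
  "ident_56_65 = {AtId}"

definition conv_56_65 :: "atom set \<Rightarrow> atom set" where
  "conv_56_65 X = X"

definition comp_56_65 :: "atom set \<Rightarrow> atom set \<Rightarrow> atom set" where
  "comp_56_65 X Y = (\<Union>x\<in>X. \<Union>y\<in>Y. atom_comp_56_65 x y)"

lemma atom_comp_table_56_65:
  "atom_comp_56_65 AtId AtId = {AtId}"
  "atom_comp_56_65 AtId AtA = {AtA}"
  "atom_comp_56_65 AtId AtB = {AtB}"
  "atom_comp_56_65 AtId AtC = {AtC}"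
  "atom_comp_56_65 AtA AtId = {AtA}"
  "atom_comp_56_65 AtA AtA = {AtId, AtB, AtC}"
  "atom_comp_56_65 AtA AtB = {AtA, AtB, AtC}"
  "atom_comp_56_65 AtA AtC = {AtA, AtB, AtC}"
  "atom_comp_56_65 AtB AtId = {AtB}"
  "atom_comp_56_65 AtB AtA = {AtA, AtB, AtC}"
  "atom_comp_56_65 AtB AtB = {AtId, AtA, AtB}"
  "atom_comp_56_65 AtB AtC = {AtA, AtC}"
  "atom_comp_56_65 AtC AtId = {AtC}"
  "atom_comp_56_65 AtC AtA = {AtA, AtB, AtC}"
  "atom_comp_56_65 AtC AtB = {AtA, AtC}"
  "atom_comp_56_65 AtC AtC = {AtId, AtA, AtB}"
proof -
  have eqI: "S = T"
    if "AtId \<in> S \<longleftrightarrow> AtId \<in> T" "AtA \<in> S \<longleftrightarrow> AtA \<in> T"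
      "AtB \<in> S \<longleftrightarrow> AtB \<in> T" "AtC \<in> S \<longleftrightarrow> AtC \<in> T" for S T
  proof (rule set_eqI)
    show "w \<in> S \<longleftrightarrow> w \<in> T" for w using that by (cases w) simp_all
  qed
  show "atom_comp_56_65 AtId AtId = {AtId}"
    by (rule eqI; simp add: atom_comp_56_65_def forbidden_56_65_def)
  show "atom_comp_56_65 AtId AtA = {AtA}"
    by (rule eqI; simp add: atom_comp_56_65_def forbidden_56_65_def)
  show "atom_comp_56_65 AtId AtB = {AtB}"
    by (rule eqI; simp add: atom_comp_56_65_def forbidden_56_65_def)
  show "atom_comp_56_65 AtId AtC = {AtC}"
    by (rule eqI; simp add: atom_comp_56_65_def forbidden_56_65_def)
  show "atom_comp_56_65 AtA AtId = {AtA}"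
    by (rule eqI; simp add: atom_comp_56_65_def forbidden_56_65_def)
  show "atom_comp_56_65 AtA AtA = {AtId, AtB, AtC}"
    by (rule eqI; simp add: atom_comp_56_65_def forbidden_56_65_def)
  show "atom_comp_56_65 AtA AtB = {AtA, AtB, AtC}"
    by (rule eqI; simp add: atom_comp_56_65_def forbidden_56_65_def)
  show "atom_comp_56_65 AtA AtC = {AtA, AtB, AtC}"
    by (rule eqI; simp add: atom_comp_56_65_def forbidden_56_65_def)
  show "atom_comp_56_65 AtB AtId = {AtB}"
    by (rule eqI; simp add: atom_comp_56_65_def forbidden_56_65_def)
  show "atom_comp_56_65 AtB AtA = {AtA, AtB, AtC}"
    by (rule eqI; simp add: atom_comp_56_65_def forbidden_56_65_def)
  show "atom_comp_56_65 AtB AtB = {AtId, AtA, AtB}"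
    by (rule eqI; simp add: atom_comp_56_65_def forbidden_56_65_def)
  show "atom_comp_56_65 AtB AtC = {AtA, AtC}"
    by (rule eqI; simp add: atom_comp_56_65_def forbidden_56_65_def)
  show "atom_comp_56_65 AtC AtId = {AtC}"
    by (rule eqI; simp add: atom_comp_56_65_def forbidden_56_65_def)
  show "atom_comp_56_65 AtC AtA = {AtA, AtB, AtC}"
    by (rule eqI; simp add: atom_comp_56_65_def forbidden_56_65_def)
  show "atom_comp_56_65 AtC AtB = {AtA, AtC}"
    by (rule eqI; simp add: atom_comp_56_65_def forbidden_56_65_def)
  show "atom_comp_56_65 AtC AtC = {AtId, AtA, AtB}"
    by (rule eqI; simp add: atom_comp_56_65_def forbidden_56_65_def)
qed

lemma atom_comp_assoc_56_65:
  "(\<exists>u\<in>atom_comp_56_65 x y. w \<in> atom_comp_56_65 u z) \<longleftrightarrow>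
   (\<exists>v\<in>atom_comp_56_65 y z. w \<in> atom_comp_56_65 x v)"
  by (cases x; cases y; cases z; cases w; simp add: atom_comp_table_56_65)

lemma atom_comp_commute_56_65: "atom_comp_56_65 x y = atom_comp_56_65 y x"
  by (cases x; cases y; simp add: atom_comp_table_56_65)

lemma atom_comp_cycle_56_65: "z \<in> atom_comp_56_65 x y \<longleftrightarrow> y \<in> atom_comp_56_65 x z"
  by (cases x; cases y; cases z; simp add: atom_comp_table_56_65)

lemma comp_56_65I:
  "x \<in> X \<Longrightarrow> y \<in> Y \<Longrightarrow> w \<in> atom_comp_56_65 x y \<Longrightarrow> w \<in> comp_56_65 X Y"
  unfolding comp_56_65_def by (intro UN_I)

lemma comp_56_65E:
  assumes "w \<in> comp_56_65 X Y"
  obtains x y where "x \<in> X" "y \<in> Y" "w \<in> atom_comp_56_65 x y"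
  using assms unfolding comp_56_65_def by (elim UN_E)

interpretation ra_56_65: relation_algebra ident_56_65 conv_56_65 comp_56_65
proof
  fix X Y Z :: "atom set"
  show "comp_56_65 (comp_56_65 X Y) Z = comp_56_65 X (comp_56_65 Y Z)"
  proof (intro set_eqI iffI)
    fix w
    assume "w \<in> comp_56_65 (comp_56_65 X Y) Z"
    then obtain u z where u: "u \<in> comp_56_65 X Y" and z: "z \<in> Z" "w \<in> atom_comp_56_65 u z"
      by (rule comp_56_65E)
    from u obtain x y where xy: "x \<in> X" "y \<in> Y" "u \<in> atom_comp_56_65 x y"
      by (rule comp_56_65E)
    from xy(3) z(2) have "\<exists>u\<in>atom_comp_56_65 x y. w \<in> atom_comp_56_65 u z" ..
    then obtain v where "v \<in> atom_comp_56_65 y z" "w \<in> atom_comp_56_65 x v"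
      unfolding atom_comp_assoc_56_65 ..
    with xy z show "w \<in> comp_56_65 X (comp_56_65 Y Z)"
      by (intro comp_56_65I)
  next
    fix w
    assume "w \<in> comp_56_65 X (comp_56_65 Y Z)"
    then obtain x v where x: "x \<in> X" and v: "v \<in> comp_56_65 Y Z" and w: "w \<in> atom_comp_56_65 x v"
      by (rule comp_56_65E)
    from v obtain y z where yz: "y \<in> Y" "z \<in> Z" "v \<in> atom_comp_56_65 y z"
      by (rule comp_56_65E)
    from yz(3) w have "\<exists>v\<in>atom_comp_56_65 y z. w \<in> atom_comp_56_65 x v" by (rule bexI [rotated])
    then obtain u where "u \<in> atom_comp_56_65 x y" "w \<in> atom_comp_56_65 u z"
      unfolding atom_comp_assoc_56_65 [symmetric] ..
    with x yz show "w \<in> comp_56_65 (comp_56_65 X Y) Z"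
      by (intro comp_56_65I)
  qed
  show "comp_56_65 (sup X Y) Z = sup (comp_56_65 X Z) (comp_56_65 Y Z)"
    by (simp add: comp_56_65_def)
  have "atom_comp_56_65 x AtId = {x}" for x
    by (simp add: atom_comp_56_65_def)
  then show "comp_56_65 X ident_56_65 = X"
    by (simp add: comp_56_65_def ident_56_65_def)
  show "conv_56_65 (conv_56_65 X) = X"
    by (simp add: conv_56_65_def)
  show "conv_56_65 (sup X Y) = sup (conv_56_65 X) (conv_56_65 Y)"
    by (simp add: conv_56_65_def)
  have comm: "comp_56_65 U V \<subseteq> comp_56_65 V U" for U V
  proof
    fix w
    assume "w \<in> comp_56_65 U V"
    then obtain x y where xy: "x \<in> U" "y \<in> V" "w \<in> atom_comp_56_65 x y"
      by (rule comp_56_65E)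
    from xy(3) have "w \<in> atom_comp_56_65 y x"
      by (subst atom_comp_commute_56_65)
    with xy(2,1) show "w \<in> comp_56_65 V U"
      by (rule comp_56_65I)
  qed
  show "conv_56_65 (comp_56_65 X Y) = comp_56_65 (conv_56_65 Y) (conv_56_65 X)"
    unfolding conv_56_65_def by (rule subset_antisym [OF comm comm])
  have "w \<notin> Y" if "w \<in> comp_56_65 X (- comp_56_65 X Y)" for w
  proof
    assume w: "w \<in> Y"
    from that obtain x y where xy: "x \<in> X" "y \<in> - comp_56_65 X Y" "w \<in> atom_comp_56_65 x y"
      by (rule comp_56_65E)
    from xy(3) have "y \<in> atom_comp_56_65 x w"
      by (rule atom_comp_cycle_56_65 [THEN iffD1])
    with xy(1) w have "y \<in> comp_56_65 X Y"
      by (rule comp_56_65I)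
    with xy(2) show False by simp
  qed
  then have "comp_56_65 X (- comp_56_65 X Y) \<subseteq> - Y"
    by (simp add: subset_iff)
  then show "sup (- Y) (comp_56_65 (conv_56_65 X) (- comp_56_65 X Y)) = - Y"
    unfolding conv_56_65_def by (rule Un_absorb2)
qed

end

theory Submission
  imports Defs Complex_Main "HOL-Library.Countable"
begin

text \<open>
  Place points on a circle of length 1, and colour two distinct points by their distance \<open>d\<close>
  along the circle: \<open>b\<close> if \<open>d < 1/6\<close>, \<open>a\<close> if \<open>1/6 < d < 1/3\<close>, and \<open>c\<close> if \<open>1/3 < d\<close>.
  Three distances either sum to 1 or one of them is the sum of the others, which excludes exactly
  the forbidden triangles, provided no \<open>d\<close> is a multiple of \<open>1/6\<close>. All other triangles are
  described by open conditions that can be met in every dense set of points. The subgroup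
  \<open>\<int>[1/5]\<close> of \<open>\<rat>\<close>, taken modulo 1, is dense and contains no nonzero multiple of \<open>1/6\<close>.
\<close>

section \<open>Representations from edge colourings\<close>

text \<open>The composition law splits into two inclusions: \<open>comp\<close> keeps forbidden
  triangles out, and \<open>wit\<close> realises every allowed triangle over every edge.\<close>

lemma square_representation_of_colouring:
  fixes D :: "'b set" and k :: "'b \<Rightarrow> 'b \<Rightarrow> atom"
  assumes id: "\<And>x y. x \<in> D \<Longrightarrow> y \<in> D \<Longrightarrow> k x y = AtId \<longleftrightarrow> x = y"
    and sym: "\<And>x y. x \<in> D \<Longrightarrow> y \<in> D \<Longrightarrow> k x y = k y x"
    and comp: "\<And>x y z. x \<in> D \<Longrightarrow> y \<in> D \<Longrightarrow> z \<in> D \<Longrightarrow> k x z \<in> atom_comp_56_65 (k x y) (k y z)"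
    and wit: "\<And>x z p q. x \<in> D \<Longrightarrow> z \<in> D \<Longrightarrow> k x z \<in> atom_comp_56_65 p q
      \<Longrightarrow> \<exists>y\<in>D. k x y = p \<and> k y z = q"
    and "D \<noteq> {}"
  shows "square_representation ident_56_65 conv_56_65 comp_56_65 D
    (\<lambda>X. {(x, y). x \<in> D \<and> y \<in> D \<and> k x y \<in> X})"
proof -
  define R where "R = (\<lambda>X. {(x, y). x \<in> D \<and> y \<in> D \<and> k x y \<in> X})"
  have R_iff: "(x, y) \<in> R X \<longleftrightarrow> x \<in> D \<and> y \<in> D \<and> k x y \<in> X" for x y X
    by (simp add: R_def)
  have colour_occurs: "\<exists>x\<in>D. \<exists>y\<in>D. k x y = p" for p
  proof -
    obtain x where x: "x \<in> D" using \<open>D \<noteq> {}\<close> by blast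
    \<comment> \<open>Applied to the loop at \<open>x\<close>, \<open>wit\<close> therefore yields
      an edge of any colour \<open>p\<close>. Injectivity of \<open>R\<close> rests on this.\<close>
    have "AtId \<in> atom_comp_56_65 p p" by (cases p) (simp_all add: atom_comp_table_56_65)
    with wit[of x x p p] id[of x x] x show ?thesis by auto
  qed
  have subset: "X \<subseteq> Y" if "R X = R Y" for X Y
  proof
    fix p assume "p \<in> X"
    obtain x y where "x \<in> D" "y \<in> D" "k x y = p" using colour_occurs by blast
    with \<open>p \<in> X\<close> that R_iff[of x y X] R_iff[of x y Y] show "p \<in> Y" by simp
  qed
  have "square_representation ident_56_65 conv_56_65 comp_56_65 D R"
  proof
    fix X Y :: "atom set"
    show "R (comp_56_65 X Y) = R X O R Y"
    proof (intro set_eqI iffI; clarify)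
      fix x z assume "(x, z) \<in> R (comp_56_65 X Y)"
      then have xz: "x \<in> D" "z \<in> D" "k x z \<in> comp_56_65 X Y" by (simp_all add: R_iff)
      from xz(3) obtain p q where pq: "p \<in> X" "q \<in> Y" "k x z \<in> atom_comp_56_65 p q"
        by (rule comp_56_65E)
      from wit[OF xz(1,2) pq(3)] pq(1,2) xz show "(x, z) \<in> R X O R Y"
        by (auto simp: R_iff)
    next
      fix x y z assume "(x, y) \<in> R X" "(y, z) \<in> R Y"
      then show "(x, z) \<in> R (comp_56_65 X Y)"
        using comp[of x y z] by (auto simp: R_iff intro: comp_56_65I)
    qed
    show "R ident_56_65 = Id_on D"
      using id by (auto simp: R_iff ident_56_65_def)
    show "R (conv_56_65 X) = {(u, v). (v, u) \<in> R X}"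
      using sym by (auto simp: R_iff conv_56_65_def)
    show "inj R"
      by (intro injI equalityI subset) simp_all
  qed (auto simp: R_def)
  then show ?thesis by (simp add: R_def)
qed

section \<open>The dense group Z[1/5]\<close>

definition pentadic :: "rat set" where
  "pentadic = {x. \<exists>n. x * 5 ^ n \<in> \<int>}"

lemma Ints_subset_pentadic: "x \<in> \<int> \<Longrightarrow> x \<in> pentadic"
  by (auto simp: pentadic_def intro: exI[of _ 0])

lemma pentadic_diff:
  assumes "x \<in> pentadic" "y \<in> pentadic"
  shows "x - y \<in> pentadic"
proof -
  obtain m n where "x * 5 ^ m \<in> \<int>" "y * 5 ^ n \<in> \<int>"
    using assms by (auto simp: pentadic_def)
  then have "(x * 5 ^ m) * 5 ^ n - (y * 5 ^ n) * 5 ^ m \<in> \<int>"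
    by (metis Ints_diff Ints_mult Ints_power Ints_numeral)
  also have "(x * 5 ^ m) * 5 ^ n - (y * 5 ^ n) * 5 ^ m = (x - y) * 5 ^ (m + n)"
    by (simp add: algebra_simps power_add)
  finally show ?thesis by (auto simp: pentadic_def)
qed

lemma pentadic_add: "x \<in> pentadic \<Longrightarrow> y \<in> pentadic \<Longrightarrow> x + y \<in> pentadic"
  using pentadic_diff[of x "0 - y"] pentadic_diff[of 0 y] Ints_subset_pentadic[of 0] by simp

lemma pentadic_frac: "x \<in> pentadic \<Longrightarrow> frac x \<in> pentadic"
  by (simp add: frac_def pentadic_diff Ints_subset_pentadic)

text \<open>Once \<open>5 ^ n\<close> exceeds \<open>1 / (v - u)\<close>, the multiples of
  \<open>1 / 5 ^ n\<close> are spaced more closely than the length of the interval.\<close>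

lemma pentadic_dense:
  assumes "u < v"
  obtains x where "x \<in> pentadic" "u < x" "x < v"
proof -
  obtain n where "1 / (v - u) < of_nat n"
    using reals_Archimedean2 by blast
  also have "(of_nat n :: rat) < 2 ^ n" by (rule of_nat_less_two_power)
  also have "(2 :: rat) ^ n \<le> 5 ^ n" by (rule power_mono) simp_all
  finally have n: "1 / (v - u) < 5 ^ n" .
  \<comment> \<open>The first multiple of \<open>1 / 5 ^ n\<close> strictly beyond \<open>u\<close>;
    the \<open>+ 1\<close> keeps it strict even if \<open>u\<close> is itself such a
    multiple.\<close>
  define x where "x = of_int (\<lfloor>u * 5 ^ n\<rfloor> + 1) / (5 :: rat) ^ n"
  have "x * 5 ^ n = of_int (\<lfloor>u * 5 ^ n\<rfloor> + 1)" by (simp add: x_def)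
  then have "x \<in> pentadic" unfolding pentadic_def by (metis (mono_tags) Ints_of_int mem_Collect_eq)
  moreover have "u < x" unfolding x_def
    by (simp add: pos_less_divide_eq) linarith
  moreover have "1 < (v - u) * 5 ^ n"
    using n assms by (simp add: divide_less_eq mult.commute)
  then have "x < v" unfolding x_def
    by (simp add: pos_divide_less_eq algebra_simps) linarith
  ultimately show ?thesis using that by blast
qed

text \<open>The base 5 matters here: as 6 is coprime to \<open>5 ^ n\<close>, the equation
  \<open>6 * k = m * 5 ^ n\<close> forces 6 to divide \<open>m\<close>.\<close>

lemma pentadic_six_times_Ints:
  assumes "x \<in> pentadic" "6 * x \<in> \<int>"
  shows "x \<in> \<int>"
proof -
  obtain n k m where k: "x * 5 ^ n = of_int k" and m: "6 * x = of_int m"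
    using assms by (auto simp: pentadic_def elim!: Ints_cases)
  have "rat_of_int (6 * k) = of_int (m * 5 ^ n)"
    using k m by (simp flip: k m)
  then have "6 * k = m * 5 ^ n" by (simp only: of_int_eq_iff)
  moreover have "coprime (6 :: int) (5 ^ n)" 
    by (intro coprime_power_right_iff[THEN iffD2] disjI1) code_simp
  ultimately have "6 dvd m"
    by (metis coprime_dvd_mult_left_iff dvd_triv_left)
  then show ?thesis using m by (auto elim!: dvdE)
qed

section \<open>Colouring the circle by distance\<close>

text \<open>The circular distance from 0 is the smaller of \<open>f\<close> and
  \<open>1 - f\<close>, so the ranges are symmetric about 1/2. Members of \<open>pentadic\<close>
  never hit the positive thresholds.\<close>

definition arc_colour :: "rat \<Rightarrow> atom" where
  "arc_colour x =
    (let f = frac x in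
     if f = 0 then AtId
     else if f < 1/6 \<or> 5/6 < f then AtB
     else if f < 1/3 \<or> 2/3 < f then AtA
     else AtC)"

lemma arc_colour_cong: "x - y \<in> \<int> \<Longrightarrow> arc_colour x = arc_colour y"
proof -
  assume "x - y \<in> \<int>"
  then obtain k where "x = y + of_int k" by (metis Ints_cases add.commute diff_add_cancel)
  then have "frac x = frac y" by (simp add: frac_def)
  then show ?thesis by (simp add: arc_colour_def)
qed

lemma arc_colour_eq_AtId_iff: "arc_colour x = AtId \<longleftrightarrow> x \<in> \<int>"
  by (simp add: arc_colour_def Let_def)

text \<open>Any of these values would make \<open>6 * frac x\<close>, hence \<open>frac x\<close>,
  an integer, hence 0. Excluding 1/2 makes one of the two arcs between distinct points strictly
  shorter.\<close>

lemma pentadic_frac_not_sixth: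
  assumes "x \<in> pentadic"
  shows "frac x \<noteq> 1/6" "frac x \<noteq> 1/3" "frac x \<noteq> 1/2" "frac x \<noteq> 2/3" "frac x \<noteq> 5/6"
proof -
  have "frac x \<noteq> of_int k / 6" if "0 < k" for k
  proof
    assume k: "frac x = of_int k / 6"
    then have "6 * frac x = of_int k" by simp
    then have "6 * frac x \<in> \<int>" by (simp only: Ints_of_int)
    then have "frac x \<in> \<int>" by (rule pentadic_six_times_Ints[OF pentadic_frac[OF assms]])
    then have "frac x = 0" by simp
    with k that show False by simp
  qed
  from this[of 1] this[of 2] this[of 3] this[of 4] this[of 5]
  show "frac x \<noteq> 1/6" "frac x \<noteq> 1/3" "frac x \<noteq> 1/2" "frac x \<noteq> 2/3" "frac x \<noteq> 5/6"
    by simp_all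
qed

lemma arc_colour_minus:
  assumes "x \<in> pentadic"
  shows "arc_colour (- x) = arc_colour x"
  using pentadic_frac_not_sixth[OF assms] frac_lt_1[of x]
  by (auto simp: arc_colour_def Let_def frac_neg)

text \<open>Reads colours off signed representatives, without reduction modulo 1. The range of
  \<open>AtC\<close> may pass 1/2 because the interval from 1/3 to 2/3 is symmetric about
  1/2.\<close>

lemma arc_colour_small:
  "0 < \<bar>x\<bar> \<Longrightarrow> \<bar>x\<bar> < 1/6 \<Longrightarrow> arc_colour x = AtB"
  "1/6 < \<bar>x\<bar> \<Longrightarrow> \<bar>x\<bar> < 1/3 \<Longrightarrow> arc_colour x = AtA"
  "1/3 < \<bar>x\<bar> \<Longrightarrow> \<bar>x\<bar> < 2/3 \<Longrightarrow> arc_colour x = AtC"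
proof -
  have "frac x = (if x < 0 then x + 1 else x)" if "\<bar>x\<bar> < 1"
    using that by (auto simp: frac_unique_iff)
  then show "0 < \<bar>x\<bar> \<Longrightarrow> \<bar>x\<bar> < 1/6 \<Longrightarrow> arc_colour x = AtB"
    "1/6 < \<bar>x\<bar> \<Longrightarrow> \<bar>x\<bar> < 1/3 \<Longrightarrow> arc_colour x = AtA"
    "1/3 < \<bar>x\<bar> \<Longrightarrow> \<bar>x\<bar> < 2/3 \<Longrightarrow> arc_colour x = AtC"
    by (auto simp: arc_colour_def Let_def)
qed

text \<open>Excludes the forbidden triangles by linear arithmetic over the possible arcs. Strict
  bounds are essential: \<open>x = y = 1/3\<close> would give three sides of colour
  \<open>AtC\<close>.\<close>

lemma arc_colour_add:
  assumes "x \<in> pentadic" "y \<in> pentadic"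
  shows "arc_colour (x + y) \<in> atom_comp_56_65 (arc_colour x) (arc_colour y)"
proof -
  have frac_ranges: "arc_colour z = AtId \<and> frac z = 0
    \<or> arc_colour z = AtB \<and> 0 < frac z \<and> frac z < 1/6
    \<or> arc_colour z = AtA \<and> 1/6 < frac z \<and> frac z < 1/3
    \<or> arc_colour z = AtC \<and> 1/3 < frac z \<and> frac z < 2/3
    \<or> arc_colour z = AtA \<and> 2/3 < frac z \<and> frac z < 5/6
    \<or> arc_colour z = AtB \<and> 5/6 < frac z \<and> frac z < 1"
    if "z \<in> pentadic" for z
    using pentadic_frac_not_sixth[OF that] frac_ge_0[of z] frac_lt_1[of z]
    unfolding arc_colour_def Let_def by (simp del: frac_eq_0_iff frac_gt_0_iff frac_ge_0)
  have "frac (x + y) = frac x + frac y \<or> frac (x + y) = frac x + frac y - 1"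
    by (auto simp: frac_add)
  with frac_ranges[OF assms(1)] frac_ranges[OF assms(2)] frac_ranges[OF pentadic_add[OF assms]]
  show ?thesis
    by (elim disjE conjE;
        simp add: atom_comp_table_56_65 del: frac_eq_0_iff frac_gt_0_iff; linarith?)
qed

section \<open>Realising the allowed triangles\<close>

text \<open>For each colour of \<open>t\<close>, an explicit open interval of positions
  \<open>s\<close> serves each allowed unordered pair of colours; density supplies a point in it,
  and \<open>swap\<close> covers the reversed pairs.\<close>

lemma arc_colour_split_half:
  assumes t: "t \<in> pentadic" "0 < t" "t < 1/2"
    and pq: "arc_colour t \<in> atom_comp_56_65 p q" "p \<noteq> AtId" "q \<noteq> AtId"
  shows "\<exists>s\<in>pentadic. arc_colour s = p \<and> arc_colour (t - s) = q"
proof -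
  let ?split = "\<lambda>p q. \<exists>s\<in>pentadic. arc_colour s = p \<and> arc_colour (t - s) = q"
  have swap: "?split q p" if pq: "?split p q" for p q
  proof -
    obtain s where "s \<in> pentadic" "arc_colour s = p" "arc_colour (t - s) = q"
      using pq by blast
    then show ?thesis using pentadic_diff[OF t(1)] by (intro bexI[of _ "t - s"]) simp_all
  qed
  have interval: "?split p q"
    if "u < v" "\<And>s. u < s \<Longrightarrow> s < v \<Longrightarrow> arc_colour s = p \<and> arc_colour (t - s) = q" for u v p q
    using pentadic_dense[OF that(1)] that(2) by metis
  have "frac t = t" using t by (simp add: frac_eq)
  then have "t \<noteq> 1/6" "t \<noteq> 1/3" using pentadic_frac_not_sixth[OF t(1)] by simp_all
  then consider "t < 1/6" | "1/6 < t" "t < 1/3" | "1/3 < t" by linarith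
  then show ?thesis
  proof cases
    case 1
    have "arc_colour t = AtB" using 1 t by (simp add: arc_colour_small)
    \<comment> \<open>In all three cases, negative endpoints put the third point before 0, and
      endpoints above \<open>t\<close> put it beyond \<open>t\<close>.\<close>
    moreover have "?split AtA AtA"
      by (rule interval[of "t + 1/6" "1/3"]) (use 1 t in \<open>simp_all add: arc_colour_small\<close>)
    moreover have "?split AtA AtB"
      by (rule interval[of "1/6" "t + 1/6"]) (use 1 t in \<open>simp_all add: arc_colour_small\<close>)
    moreover have "?split AtA AtC"
      by (rule interval[of "- 1/3" "t - 1/3"]) (use 1 t in \<open>simp_all add: arc_colour_small\<close>)
    moreover have "?split AtB AtB"
      by (rule interval[of 0 t]) (use 1 t in \<open>simp_all add: arc_colour_small\<close>)
    moreover have "?split AtC AtC"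
      by (rule interval[of "t + 1/3" "1/2"]) (use 1 t in \<open>simp_all add: arc_colour_small\<close>)
    ultimately show ?thesis
      using pq swap by (cases p; cases q) (simp_all add: atom_comp_table_56_65)
  next
    case 2
    have "arc_colour t = AtA" using 2 t by (simp add: arc_colour_small)
    moreover have "?split AtB AtA"
      by (rule interval[of "t - 1/3" 0]) (use 2 t in \<open>simp_all add: arc_colour_small\<close>)
    moreover have "?split AtA AtC"
      by (rule interval[of "t - 1/2" "- 1/6"]) (use 2 t in \<open>simp_all add: arc_colour_small\<close>)
    moreover have "?split AtB AtB"
      by (rule interval[of "t - 1/6" "1/6"]) (use 2 t in \<open>simp_all add: arc_colour_small\<close>)
    moreover have "?split AtB AtC"
      by (rule interval[of "- 1/6" "t - 1/3"]) (use 2 t in \<open>simp_all add: arc_colour_small\<close>)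
    moreover have "?split AtC AtC"
      by (rule interval[of "t + 1/3" "2/3"]) (use 2 t in \<open>simp_all add: arc_colour_small\<close>)
    ultimately show ?thesis
      using pq swap by (cases p; cases q) (simp_all add: atom_comp_table_56_65)
  next
    case 3
    have "arc_colour t = AtC" using 3 t by (simp add: arc_colour_small)
    moreover have "?split AtA AtA"
      by (rule interval[of "1/6" "t - 1/6"]) (use 3 t in \<open>simp_all add: arc_colour_small\<close>)
    moreover have "?split AtA AtB"
      by (rule interval[of "t - 1/6" "1/3"]) (use 3 t in \<open>simp_all add: arc_colour_small\<close>)
    moreover have "?split AtA AtC"
      \<comment> \<open>This interval is nonempty precisely because \<open>t < 1/2\<close>.\<close>
      by (rule interval[of "t - 2/3" "- 1/6"]) (use 3 t in \<open>simp_all add: arc_colour_small\<close>)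
    moreover have "?split AtB AtC"
      by (rule interval[of "- 1/6" 0]) (use 3 t in \<open>simp_all add: arc_colour_small\<close>)
    ultimately show ?thesis
      using pq swap by (cases p; cases q) (simp_all add: atom_comp_table_56_65)
  qed
qed

lemma arc_colour_split:
  assumes t: "t \<in> pentadic" and pq: "arc_colour t \<in> atom_comp_56_65 p q"
  shows "\<exists>s\<in>pentadic. arc_colour s = p \<and> arc_colour (t - s) = q"
proof -
  have zero: "0 \<in> pentadic" "arc_colour 0 = AtId"
    by (simp_all add: Ints_subset_pentadic arc_colour_eq_AtId_iff)
  consider "p = AtId" | "q = AtId" | "p \<noteq> AtId" "q \<noteq> AtId" "t \<in> \<int>"
    | "p \<noteq> AtId" "q \<noteq> AtId" "t \<notin> \<int>" by blast
  then show ?thesis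
  proof cases
    case 1
    then show ?thesis using zero pq by (auto simp: atom_comp_56_65_def intro!: bexI[of _ 0])
  next
    case 2
    then show ?thesis
      using zero pq t by (auto simp: atom_comp_56_65_def split: if_splits intro!: bexI[of _ t])
  next
    case 3
    then have "arc_colour t = AtId" by (simp add: arc_colour_eq_AtId_iff)
    with 3 pq have "p = q" by (auto simp: atom_comp_56_65_def)
    have "\<exists>s\<in>pentadic. arc_colour s = p"
    proof -
      have "\<exists>s\<in>pentadic. u < s \<and> s < v" if "u < v" for u v
        using pentadic_dense[OF that] by metis
      \<comment> \<open>One interval for each of the colours \<open>AtB\<close>, \<open>AtA\<close>
        and \<open>AtC\<close>, in this order.\<close>
      from this[of 0 "1/6"] this[of "1/6" "1/3"] this[of "1/3" "1/2"] \<open>p \<noteq> AtId\<close>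
      show ?thesis by (cases p) (force simp: arc_colour_small)+
    qed
    then obtain s where s: "s \<in> pentadic" "arc_colour s = p" by blast
    have "arc_colour (t - s) = arc_colour (- s)"
      using \<open>t \<in> \<int>\<close> by (intro arc_colour_cong) simp
    with s \<open>p = q\<close> show ?thesis by (auto simp: arc_colour_minus)
  next
    case 4
    let ?f = "frac t"
    have f: "?f \<in> pentadic" "0 < ?f" "?f < 1" "?f \<noteq> 1/2"
      using t 4 pentadic_frac_not_sixth[OF t] by (simp_all add: pentadic_frac frac_lt_1)
    have t_f: "t - ?f \<in> \<int>" by (simp add: frac_def)
    then have "arc_colour t = arc_colour ?f" by (rule arc_colour_cong)
    show ?thesis
    proof (cases "?f < 1/2")
      case True
      obtain s where s: "s \<in> pentadic" "arc_colour s = p" "arc_colour (?f - s) = q"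
        using arc_colour_split_half[of ?f p q] f True 4 pq \<open>arc_colour t = arc_colour ?f\<close> by auto
      have "arc_colour (t - s) = arc_colour (?f - s)"
        using t_f by (intro arc_colour_cong) simp
      with s show ?thesis by auto
    next
      case False
      \<comment> \<open>Reflecting the circle preserves colours and turns \<open>?f\<close> into
        \<open>1 - ?f\<close>, which is below 1/2. A split \<open>s\<close> of the reflected point
        is then reflected back to \<open>- s\<close>.\<close>
      have g: "1 - ?f \<in> pentadic" using f by (simp add: pentadic_diff Ints_subset_pentadic)
      have "arc_colour (1 - ?f) = arc_colour (- ?f)" by (rule arc_colour_cong) simp
      also have "\<dots> = arc_colour t"
        using f \<open>arc_colour t = arc_colour ?f\<close> by (simp add: arc_colour_minus)
      finally obtain s where s: "s \<in> pentadic" "arc_colour s = p" "arc_colour (1 - ?f - s) = q"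
        using arc_colour_split_half[of "1 - ?f" p q] f False 4 pq g by auto
      have "(t - - s) - (- (1 - ?f - s)) = (t - ?f) + 1" by simp
      also have "\<dots> \<in> \<int>" using t_f by (intro Ints_add Ints_1)
      finally have "arc_colour (t - - s) = arc_colour (- (1 - ?f - s))"
        by (rule arc_colour_cong)
      also have "\<dots> = q" using s arc_colour_minus[OF pentadic_diff[OF g s(1)]] by (simp only:)
      finally show ?thesis
        using s pentadic_diff[OF zero(1) s(1)] by (intro bexI[of _ "- s"]) (simp_all add: arc_colour_minus)
    qed
  qed
qed

section \<open>Transfer to the natural numbers\<close>

theorem proposition4p26:
  "\<exists>(B :: nat set) (R :: atom set \<Rightarrow> (nat \<times> nat) set).
     square_representation ident_56_65 conv_56_65 comp_56_65 B R"
proof -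
  \<comment> \<open>\<open>P\<close> holds one representative of each class of Z[1/5] modulo 1, and
    \<open>to_nat\<close> encodes these rationals as naturals.\<close>
  define P where "P = pentadic \<inter> {0..<1}"
  define k where "k = (\<lambda>m n. arc_colour (from_nat n - from_nat m))"
  have from_P: "x \<in> to_nat ` P \<longleftrightarrow> from_nat x \<in> P \<and> to_nat (from_nat x :: rat) = x" for x
    by (metis from_nat_to_nat image_iff)
  have pent: "x \<in> P \<Longrightarrow> x \<in> pentadic" for x by (simp add: P_def)
  have "square_representation ident_56_65 conv_56_65 comp_56_65 (to_nat ` P)
    (\<lambda>X. {(x, y). x \<in> to_nat ` P \<and> y \<in> to_nat ` P \<and> k x y \<in> X})"
  proof (rule square_representation_of_colouring)
    fix m n z p q
    assume m: "m \<in> to_nat ` P" and z: "z \<in> to_nat ` P"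
    show "k m z = k z m"
      using m z arc_colour_minus[of "from_nat z - from_nat m"]
      by (auto simp: k_def pent pentadic_diff)
    show "k m z = AtId \<longleftrightarrow> m = z"
    proof
      obtain x y where xy: "x \<in> P" "y \<in> P" "m = to_nat x" "z = to_nat y" using m z by blast
      assume "k m z = AtId"
      then obtain i where "y - x = of_int i"
        using xy by (auto simp: k_def arc_colour_eq_AtId_iff elim: Ints_cases)
      \<comment> \<open>Two representatives in the half-open unit interval differ by less than 1, so
        an integer difference must vanish.\<close>
      moreover have "-1 < y - x" "y - x < 1" using xy by (auto simp: P_def)
      ultimately have "i = 0" by simp
      with \<open>y - x = of_int i\<close> xy show "m = z" by simp
    qed (simp add: k_def arc_colour_eq_AtId_iff)
    show "k m z \<in> atom_comp_56_65 (k m n) (k n z)" if "n \<in> to_nat ` P"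
      using that m z arc_colour_add[of "from_nat n - from_nat m" "from_nat z - from_nat n"]
      by (auto simp: k_def pent pentadic_diff)
    assume "k m z \<in> atom_comp_56_65 p q"
    then obtain s where s: "s \<in> pentadic" "arc_colour s = p"
      "arc_colour (from_nat z - from_nat m - s) = q"
      using arc_colour_split[of "from_nat z - from_nat m" p q] m z
      by (auto simp: k_def pent pentadic_diff)
    \<comment> \<open>The split \<open>s\<close> is a displacement from \<open>m\<close>;
      \<open>frac\<close> brings the endpoint back into \<open>P\<close> and changes differences
      only by integers, so colours are kept.\<close>
    let ?y = "frac (from_nat m + s)"
    have "from_nat m \<in> P" using m from_P by blast
    then have "?y \<in> P"
      using s pent by (simp add: P_def pentadic_frac pentadic_add frac_lt_1)
    moreover have "arc_colour (?y - from_nat m) = arc_colour s"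
      by (rule arc_colour_cong) (simp add: frac_def)
    moreover have "arc_colour (from_nat z - ?y) = arc_colour (from_nat z - from_nat m - s)"
      by (rule arc_colour_cong) (simp add: frac_def)
    ultimately show "\<exists>y\<in>to_nat ` P. k m y = p \<and> k y z = q"
      using s by (intro bexI[of _ "to_nat ?y"]) (simp_all add: k_def)
  next
    show "to_nat ` P \<noteq> {}" using Ints_subset_pentadic[of 0] by (auto simp: P_def)
  qed
  then show ?thesis by blast
qed

end
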